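(* Let $K$ be an infinite field, $n\ge 2$, and $S=K[x_1,\ldots,x_n]$. Let $I\subset S$ be a $\mathcal{D}$-fixed ideal. Then $\mathrm{reg}(I)\le n\cdot(\deg(I)-1)+1$. In particular, if $e\ge n\cdot(\deg(I)-1)+1$, then $I_{\ge e}$ is stable.
   Context: $S=K[x_1,\ldots,x_n]$ has the standard grading. A $\mathbf{d}$-sequence is a strictly increasing sequence of positive integers $\mathbf{d}: 1=d_0\mid d_1\mid\cdots\mid d_s$ (each dividing the next). Every $a\in\mathbb{N}$ has a unique $\mathbf{d}$-decomposition $a=\sum_{t=0}^s a_td_t$ with nonnegative integers $a_t$ and $0\le a_t<d_{t+1}/d_t$ for $0\le t<s$. For $a=\sum a_td_t$ and $b=\sum b_td_t$ so decomposed, write $a\le_{\mathbf{d}}b$ if $a_t\le b_t$ for all $0\le t\le s$. A monomial ideal $I\subset S$ is $\mathbf{d}$-fixed if for every monomial $u\in I$ and all $1\le j<i\le n$, if $t\le_{\mathbf{d}}\nu_i(u)$ then $u\cdot x_j^t/x_i^t\in I$, where $\nu_i(u)$ is the exponent of $x_i$ in $u$. A monomial ideal is $\mathcal{D}$-fixed if it is a sum of $\mathbf{d}$-fixed ideals, for various $\mathbf{d}$-sequences (different summands may use different $\mathbf{d}$-sequences). For a monomial $u\ne 1$, $m(u)=\max\{i: x_i\mid u\}$. A monomial ideal $I$ is stable if for every monomial $u\in I$, $u\neq 1$, and every $i<m(u)$ one has $x_iu/x_{m(u)}\in I$. $\deg(I)$ is the maximum degree of a minimal monomial generator of $I$, and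 for an integer $e$, $I_{\ge e}$ is the ideal generated by the monomials of degree $\ge e$ in $I$. $\mathrm{reg}(I)$ is the Castelnuovo-Mumford regularity of $I$ as a graded $S$-module, $\mathrm{reg}(I)=\max\{j-i: \mathrm{Tor}_i^S(I,K)_j\ne 0\}$.
   Formalization: The regularity bound is stated only for proper ideals I ≠ S, because for I = S one has deg(I) = 0 and reg(I) = 0 > 1 − n; the stability claim covers all I. *)

theory Defs
  imports
    "HOL-Library.Poly_Mapping"
    "HOL-Library.Cardinality"
    "HOL-Library.Extended_Real"
    "Jordan_Normal_Form.Matrix_Kernel"
begin

text \<open>
  The polynomial ring \<open>S = K[x\<^sub>1, \<dots>, x\<^sub>n]\<close>: the variables are the elements of a finite linearly
  ordered type \<open>'n\<close> (so \<open>n = CARD('n)\<close>, and the order of the type is the order of the indices of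
  the variables), and monomials are identified with their exponents.
\<close>

type_synonym ('n, 'k) mpoly = "('n \<Rightarrow>\<^sub>0 nat) \<Rightarrow>\<^sub>0 'k"

definition monomial :: "('n \<Rightarrow>\<^sub>0 nat) \<Rightarrow> ('n, 'k::comm_ring_1) mpoly" where
  "monomial u = Poly_Mapping.single u 1"

definition mdeg :: "('n::finite \<Rightarrow>\<^sub>0 nat) \<Rightarrow> nat" where
  "mdeg u = (\<Sum>i\<in>UNIV. Poly_Mapping.lookup u i)"

definition ideal_gen :: "'a::comm_ring_1 set \<Rightarrow> 'a set" where
  "ideal_gen A = Modules.module.span (*) A"

definition monomial_ideal :: "('n, 'k::comm_ring_1) mpoly set \<Rightarrow> bool" where
  "monomial_ideal I \<longleftrightarrow> (\<exists>A. I = ideal_gen (monomial ` A))"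

definition min_gens :: "('n, 'k::comm_ring_1) mpoly set \<Rightarrow> ('n \<Rightarrow>\<^sub>0 nat) set" where
  "min_gens I = {u. monomial u \<in> I \<and> (\<forall>v w. monomial v \<in> I \<longrightarrow> u = v + w \<longrightarrow> w = 0)}"

text \<open>For the zero ideal, which has no generators, the value is unspecified.\<close>

definition ideal_deg :: "('n::finite, 'k::comm_ring_1) mpoly set \<Rightarrow> nat" where
  "ideal_deg I = Max (mdeg ` min_gens I)"

definition truncation_ge :: "int \<Rightarrow> ('n::finite, 'k::comm_ring_1) mpoly set \<Rightarrow> ('n, 'k) mpoly set" where
  "truncation_ge e I = ideal_gen (monomial ` {u. monomial u \<in> I \<and> int (mdeg u) \<ge> e})"

definition stable_ideal :: "('n::{finite,linorder}, 'k::comm_ring_1) mpoly set \<Rightarrow> bool" where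
  "stable_ideal I \<longleftrightarrow> monomial_ideal I \<and>
    (\<forall>u. monomial u \<in> I \<longrightarrow> u \<noteq> 0 \<longrightarrow>
      (let m = Max (Poly_Mapping.keys u) in
        \<forall>i<m. monomial (u - Poly_Mapping.single m 1 + Poly_Mapping.single i 1) \<in> I))"


text \<open>The sequence \<open>1 = d\<^sub>0 | d\<^sub>1 | \<dots> | d\<^sub>s\<close> is the list \<open>ds\<close> of length \<open>s + 1\<close>.\<close>

definition d_sequence :: "nat list \<Rightarrow> bool" where
  "d_sequence ds \<longleftrightarrow> ds \<noteq> [] \<and> ds ! 0 = 1 \<and> sorted_wrt (<) ds \<and>
    (\<forall>t. Suc t < length ds \<longrightarrow> ds ! t dvd ds ! Suc t)"

definition d_decomposition :: "nat list \<Rightarrow> nat \<Rightarrow> nat list \<Rightarrow> bool" where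
  "d_decomposition ds a as \<longleftrightarrow> length as = length ds \<and>
    a = (\<Sum>t<length ds. as ! t * ds ! t) \<and>
    (\<forall>t. Suc t < length ds \<longrightarrow> as ! t < ds ! Suc t div ds ! t)"

definition le_d :: "nat list \<Rightarrow> nat \<Rightarrow> nat \<Rightarrow> bool" where
  "le_d ds a b \<longleftrightarrow> (\<exists>as bs. d_decomposition ds a as \<and> d_decomposition ds b bs \<and>
    (\<forall>t<length ds. as ! t \<le> bs ! t))"

text \<open>
  If \<open>t \<le>\<^sub>d \<nu>\<^sub>i(u)\<close> then \<open>t \<le> \<nu>\<^sub>i(u)\<close>, so the subtraction of exponents below is exact.
\<close>

definition d_fixed :: "nat list \<Rightarrow> ('n::{finite,linorder}, 'k::comm_ring_1) mpoly set \<Rightarrow> bool" where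
  "d_fixed ds I \<longleftrightarrow> monomial_ideal I \<and>
    (\<forall>u i j t. monomial u \<in> I \<longrightarrow> j < i \<longrightarrow> le_d ds t (Poly_Mapping.lookup u i) \<longrightarrow>
      monomial (u - Poly_Mapping.single i t + Poly_Mapping.single j t) \<in> I)"

text \<open>
  The sum of a family of ideals is the ideal generated by its union.  As \<open>S\<close> is Noetherian, it is
  the sum of a finite subfamily, so it does not matter that \<open>\<F>\<close> is not required to be finite.
\<close>

definition D_fixed :: "('n::{finite,linorder}, 'k::comm_ring_1) mpoly set \<Rightarrow> bool" where
  "D_fixed I \<longleftrightarrow> (\<exists>\<F>. (\<forall>J\<in>\<F>. \<exists>ds. d_sequence ds \<and> d_fixed ds J) \<and> I = ideal_gen (\<Union>\<F>))"


definition homogeneous :: "int \<Rightarrow> ('n::finite, 'k::comm_ring_1) mpoly \<Rightarrow> bool" where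
  "homogeneous d p \<longleftrightarrow> (\<forall>u\<in>Poly_Mapping.keys p. int (mdeg u) = d)"

text \<open>
  A graded free resolution \<open>\<cdots> \<rightarrow> F\<^sub>1 \<rightarrow> F\<^sub>0 \<rightarrow> I \<rightarrow> 0\<close> by graded free \<open>S\<close>-modules of finite rank:
  \<open>F\<^sub>i\<close> has a homogeneous basis indexed by \<open>l < dim_col (D i)\<close>, whose \<open>l\<close>-th element has degree
  \<open>g i l\<close>.  The matrix of \<open>F\<^sub>i\<^sub>+\<^sub>1 \<rightarrow> F\<^sub>i\<close> is \<open>D (Suc i)\<close>, and \<open>D 0\<close> is the one-row matrix of the
  augmentation \<open>F\<^sub>0 \<rightarrow> S\<close> with image \<open>I\<close>.
\<close>

definition graded_free_resolution ::
  "('n::finite, 'k::comm_ring_1) mpoly set \<Rightarrow> (nat \<Rightarrow> nat \<Rightarrow> int) \<Rightarrow> (nat \<Rightarrow> ('n, 'k) mpoly mat) \<Rightarrow> bool"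
where
  "graded_free_resolution I g D \<longleftrightarrow>
    dim_row (D 0) = 1 \<and>
    (\<forall>i. dim_row (D (Suc i)) = dim_col (D i)) \<and>
    (\<forall>l<dim_col (D 0). homogeneous (g 0 l) (D 0 $$ (0, l))) \<and>
    (\<forall>i. \<forall>k<dim_row (D (Suc i)). \<forall>l<dim_col (D (Suc i)).
      homogeneous (g (Suc i) l - g i k) (D (Suc i) $$ (k, l))) \<and>
    (\<lambda>v. D 0 *\<^sub>v v) ` carrier_vec (dim_col (D 0)) = {y \<in> carrier_vec 1. y $ 0 \<in> I} \<and>
    (\<forall>i. (\<lambda>v. D (Suc i) *\<^sub>v v) ` carrier_vec (dim_col (D (Suc i))) = mat_kernel (D i))"

text \<open>
  \<open>Tor\<^sub>i(I, K)\<close> is the \<open>i\<close>-th homology of the complex \<open>F \<otimes> K\<close>, where \<open>K = S/(x\<^sub>1, \<dots>, x\<^sub>n)\<close>: the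
  module \<open>F\<^sub>i \<otimes> K\<close> is the \<open>K\<close>-space on the basis of \<open>F\<^sub>i\<close>, and the differentials are obtained by
  passing to constant terms (the augmentation is dropped).  The graded component of degree \<open>j\<close> of
  \<open>F\<^sub>i \<otimes> K\<close> is spanned by the basis elements of degree \<open>j\<close>.
\<close>

definition tensor_diff :: "(nat \<Rightarrow> ('n, 'k::comm_ring_1) mpoly mat) \<Rightarrow> nat \<Rightarrow> 'k mat" where
  "tensor_diff D i = map_mat (\<lambda>p. Poly_Mapping.lookup p 0) (D i)"

definition tensor_component ::
  "(nat \<Rightarrow> nat \<Rightarrow> int) \<Rightarrow> (nat \<Rightarrow> ('n, 'k::comm_ring_1) mpoly mat) \<Rightarrow> nat \<Rightarrow> int \<Rightarrow> 'k vec set"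
where
  "tensor_component g D i j =
    {v \<in> carrier_vec (dim_col (D i)). \<forall>l<dim_col (D i). g i l \<noteq> j \<longrightarrow> v $ l = 0}"

definition tor_cycles ::
  "(nat \<Rightarrow> nat \<Rightarrow> int) \<Rightarrow> (nat \<Rightarrow> ('n, 'k::comm_ring_1) mpoly mat) \<Rightarrow> nat \<Rightarrow> int \<Rightarrow> 'k vec set"
where
  "tor_cycles g D i j =
    (if i = 0 then tensor_component g D i j
     else tensor_component g D i j \<inter> mat_kernel (tensor_diff D i))"

definition tor_boundaries ::
  "(nat \<Rightarrow> nat \<Rightarrow> int) \<Rightarrow> (nat \<Rightarrow> ('n, 'k::comm_ring_1) mpoly mat) \<Rightarrow> nat \<Rightarrow> int \<Rightarrow> 'k vec set"
where
  "tor_boundaries g D i j = (\<lambda>v. tensor_diff D (Suc i) *\<^sub>v v) ` tensor_component g D (Suc i) j"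

text \<open>
  \<open>Tor\<^sub>i(I, K)\<^sub>j \<noteq> 0\<close>.  Up to isomorphism \<open>Tor\<close> does not depend on the resolution, and every
  homogeneous ideal of \<open>S\<close> has a graded free resolution of this kind.
\<close>

definition Tor_nonzero :: "('n::finite, 'k::comm_ring_1) mpoly set \<Rightarrow> nat \<Rightarrow> int \<Rightarrow> bool" where
  "Tor_nonzero I i j \<longleftrightarrow>
    (\<exists>g D. graded_free_resolution I g D \<and> \<not> tor_cycles g D i j \<subseteq> tor_boundaries g D i j)"

text \<open>The supremum is a maximum, except that it is \<open>-\<infinity>\<close> for the zero ideal.\<close>

definition reg :: "('n::finite, 'k::field) mpoly set \<Rightarrow> ereal" where
  "reg I = Sup {ereal (of_int (j - int i)) |i j. Tor_nonzero I i j}"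

end

theory Submission
  imports Defs
begin

text \<open>
  Put \<open>d = deg I\<close> and \<open>e = n (d - 1) + 1\<close>.  In a \<open>\<^bold>d\<close>-fixed ideal the exponents of a monomial at all
  variables after \<open>x\<^sub>k\<close> may be moved to \<open>x\<^sub>k\<close>, since \<open>t \<le>\<^sub>d t\<close>.  Let \<open>u \<in> I\<close> have degree at least
  \<open>e\<close>, and let \<open>u' = x\<^sub>i u / x\<^sub>m\<close> with \<open>i < m = m(u)\<close>.  By the pigeonhole principle some \<open>x\<^sub>k\<close> with
  \<open>k \<le> m\<close> has exponent at least \<open>d\<close> in \<open>u'\<close>; moving to \<open>x\<^sub>k\<close> the later exponents of a generator
  dividing \<open>u\<close> gives an element of \<open>I\<close> that divides \<open>u'\<close>.  Hence \<open>I\<^sub>\<ge>\<^sub>e\<close> is stable.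

  For the regularity, let \<open>F\<close> be a graded free resolution of \<open>I\<close>, augmented by \<open>F\<^sub>0 \<rightarrow> S\<close>.  For every
  final segment \<open>X\<close> of the variables, the homology of \<open>F \<otimes> S/(X)\<close> at \<open>F\<^sub>i\<close> vanishes in degrees
  \<open>j > i + e\<close>.  This goes by induction on \<open>X\<close>: adding the next smaller variable \<open>x\<^sub>b\<close>, which is a
  nonzerodivisor modulo \<open>(X)\<close>, the homology at \<open>F\<^sub>i\<close> in degree \<open>j\<close> is controlled by that for \<open>X\<close> at
  \<open>F\<^sub>i\<close> in degree \<open>j\<close> and at \<open>F\<^sub>i\<^sub>-\<^sub>1\<close> in degree \<open>j - 1\<close>.  For \<open>i = 0\<close> the claim says that
  \<open>I \<inter> (X)\<close> and \<open>(X) I\<close> agree in degrees above \<open>e\<close>, which follows from stability.  Taking all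
  variables for \<open>X\<close> gives the vanishing of \<open>Tor\<close>.
\<close>

section \<open>Monomials, degrees and monomial ideals\<close>

interpretation ideal: Modules.module "(*) :: 'a::comm_ring_1 \<Rightarrow> 'a \<Rightarrow> 'a"
  by unfold_locales (auto simp: algebra_simps)

lemma mdeg_add: "mdeg (u + v) = mdeg u + mdeg v"
  by (simp add: mdeg_def lookup_add sum.distrib)

lemma mdeg_single [simp]: "mdeg (Poly_Mapping.single i t) = t"
proof -
  have "mdeg (Poly_Mapping.single i t) = (\<Sum>k\<in>UNIV. if k = i then t else 0)"
    unfolding mdeg_def by (intro sum.cong) (auto simp: lookup_single when_def)
  then show ?thesis by simp
qed

lemma mdeg_eq_0_iff: "mdeg u = 0 \<longleftrightarrow> u = 0"
  by (auto simp: mdeg_def intro: poly_mapping_eqI)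

lemma lookup_le_mdeg: "Poly_Mapping.lookup u i \<le> mdeg u"
  unfolding mdeg_def by (intro member_le_sum) auto

lemma minus_single_plus:
  "t \<le> Poly_Mapping.lookup u i \<Longrightarrow> u - Poly_Mapping.single i t + Poly_Mapping.single i t = (u :: 'n \<Rightarrow>\<^sub>0 nat)"
  by (rule poly_mapping_eqI) (auto simp: lookup_add lookup_minus lookup_single when_def)

lemma exponent_le_imp_add:
  assumes "\<And>i. Poly_Mapping.lookup a i \<le> Poly_Mapping.lookup u i"
  obtains w where "u = a + (w :: 'n \<Rightarrow>\<^sub>0 nat)"
proof
  show "u = a + (u - a)"
    using assms by (intro poly_mapping_eqI) (simp add: lookup_add lookup_minus)
qed

lemma poly_mapping_sum_single:
  "(\<Sum>u\<in>Poly_Mapping.keys p. Poly_Mapping.single u (Poly_Mapping.lookup p u)) = p"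
proof (rule poly_mapping_eqI)
  fix v
  have "(\<Sum>u\<in>Poly_Mapping.keys p. Poly_Mapping.lookup p u when u = v) =
      (\<Sum>u\<in>Poly_Mapping.keys p. if u = v then Poly_Mapping.lookup p u else 0)"
    by (intro sum.cong) (auto simp: when_def)
  then show "Poly_Mapping.lookup (\<Sum>u\<in>Poly_Mapping.keys p.
      Poly_Mapping.single u (Poly_Mapping.lookup p u)) v = Poly_Mapping.lookup p v"
    by (simp add: lookup_sum lookup_single sum.delta in_keys_iff)
qed

lemma keys_monomial [simp]: "Poly_Mapping.keys (monomial u :: ('n, 'k::comm_ring_1) mpoly) = {u}"
  by (simp add: monomial_def)

text \<open>Polynomials all of whose monomials are multiples of exponents in \<open>A\<close> form
  an ideal; conversely, \<open>p\<close> is split into its terms.\<close>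

lemma mem_ideal_gen_monomial_iff:
  fixes A :: "('n \<Rightarrow>\<^sub>0 nat) set" and p :: "('n, 'k::comm_ring_1) mpoly"
  shows "p \<in> ideal_gen (monomial ` A) \<longleftrightarrow> (\<forall>u\<in>Poly_Mapping.keys p. \<exists>a\<in>A. \<exists>w. u = a + w)"
proof
  assume "p \<in> ideal_gen (monomial ` A)"
  then have "p \<in> ideal.span (monomial ` A)" by (simp add: ideal_gen_def)
  then show "\<forall>u\<in>Poly_Mapping.keys p. \<exists>a\<in>A. \<exists>w. u = a + w"
  proof (induction rule: ideal.span_induct_alt)
    case base
    then show ?case by simp
  next
    case (step c x y)
    then obtain a where a: "a \<in> A" "x = monomial a" by auto
    have "Poly_Mapping.keys (c * x + y) \<subseteq> Poly_Mapping.keys (c * x) \<union> Poly_Mapping.keys y"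
      by (rule keys_add)
    moreover have "Poly_Mapping.keys (c * x) \<subseteq> {u + v |u v. u \<in> Poly_Mapping.keys c \<and> v \<in> Poly_Mapping.keys x}"
      by (rule keys_mult)
    ultimately show ?case using step.IH a
      by (fastforce simp: add.commute)
  qed
next
  assume *: "\<forall>u\<in>Poly_Mapping.keys p. \<exists>a\<in>A. \<exists>w. u = a + w"
  have "(\<Sum>u\<in>Poly_Mapping.keys p. Poly_Mapping.single u (Poly_Mapping.lookup p u)) \<in> ideal.span (monomial ` A)"
  proof (rule ideal.span_sum)
    fix u assume "u \<in> Poly_Mapping.keys p"
    with * obtain a w where a: "a \<in> A" "u = a + w" by blast
    have "Poly_Mapping.single u (Poly_Mapping.lookup p u) =
        Poly_Mapping.single w (Poly_Mapping.lookup p u) * monomial a"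
      by (simp add: monomial_def mult_single a add.commute)
    then show "Poly_Mapping.single u (Poly_Mapping.lookup p u) \<in> ideal.span (monomial ` A)"
      using a by (simp add: ideal.span_scale ideal.span_base)
  qed
  then show "p \<in> ideal_gen (monomial ` A)"
    by (simp add: ideal_gen_def poly_mapping_sum_single)
qed

text \<open>A monomial ideal is determined by this set, so questions about it reduce to divisibility
  of exponents.\<close>

definition exponents :: "('n, 'k::comm_ring_1) mpoly set \<Rightarrow> ('n \<Rightarrow>\<^sub>0 nat) set" where
  "exponents I = {u. monomial u \<in> I}"

lemma monomial_mem_iff: "monomial u \<in> I \<longleftrightarrow> u \<in> exponents I"
  by (simp add: exponents_def)

lemma mem_exponents_ideal_gen:
  "u \<in> exponents (ideal_gen (monomial ` A) :: ('n, 'k::comm_ring_1) mpoly set) \<longleftrightarrow> (\<exists>a\<in>A. \<exists>w. u = a + w)"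
  by (simp add: exponents_def mem_ideal_gen_monomial_iff)

lemma monomial_ideal_mem_iff:
  assumes "monomial_ideal I"
  shows "p \<in> I \<longleftrightarrow> Poly_Mapping.keys p \<subseteq> exponents I"
  using assms by (auto simp: monomial_ideal_def subset_iff mem_exponents_ideal_gen mem_ideal_gen_monomial_iff)

lemma monomial_ideal_exponents_add:
  assumes "monomial_ideal I" "u \<in> exponents I"
  shows "u + w \<in> exponents I"
  using assms by (fastforce simp: monomial_ideal_def mem_exponents_ideal_gen add.assoc)

lemma monomial_ideal_eq_UNIV:
  fixes I :: "('n, 'k::comm_ring_1) mpoly set"
  assumes "monomial_ideal I" "0 \<in> exponents I"
  shows "exponents I = UNIV" "I = UNIV"
proof -
  show U: "exponents I = UNIV"
    using monomial_ideal_exponents_add[OF assms] by auto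
  show "I = UNIV"
    using monomial_ideal_mem_iff[OF assms(1)] U by auto
qed

text \<open>The union of monomial generating sets generates the sum, and a multiple of one of these
  generators lies in the summand of that generator. Hence each monomial of a \<open>D_fixed\<close>
  ideal already lies in a single \<open>d_fixed\<close> summand.\<close>

lemma monomial_ideal_sum:
  fixes \<F> :: "('n, 'k::comm_ring_1) mpoly set set"
  assumes "\<And>J. J \<in> \<F> \<Longrightarrow> monomial_ideal J"
  shows "monomial_ideal (ideal_gen (\<Union>\<F>))"
    and "exponents (ideal_gen (\<Union>\<F>)) = (\<Union>J\<in>\<F>. exponents J)"
proof -
  obtain A where A: "\<And>J. J \<in> \<F> \<Longrightarrow> ideal_gen (monomial ` A J) = J"
    using assms unfolding monomial_ideal_def by metis
  have eq: "ideal_gen (\<Union>\<F>) = ideal_gen (monomial ` (\<Union>J\<in>\<F>. A J))"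
  proof
    have "J \<subseteq> ideal_gen (monomial ` (\<Union>J\<in>\<F>. A J))" if "J \<in> \<F>" for J
    proof -
      have "ideal_gen (monomial ` A J :: ('n, 'k) mpoly set) \<subseteq> ideal_gen (monomial ` (\<Union>J\<in>\<F>. A J))"
        using that unfolding ideal_gen_def by (intro ideal.span_mono) auto
      then show ?thesis unfolding A[OF that] .
    qed
    then have "\<Union>\<F> \<subseteq> ideal_gen (monomial ` (\<Union>J\<in>\<F>. A J))"
      by (rule Union_least)
    then show "ideal_gen (\<Union>\<F>) \<subseteq> ideal_gen (monomial ` (\<Union>J\<in>\<F>. A J))"
      unfolding ideal_gen_def by (intro ideal.span_minimal ideal.subspace_span)
    have "monomial ` A J \<subseteq> J" if "J \<in> \<F>" for J
    proof -
      have "(monomial ` A J :: ('n, 'k) mpoly set) \<subseteq> ideal_gen (monomial ` A J)"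
        unfolding ideal_gen_def by (rule ideal.span_superset)
      then show ?thesis unfolding A[OF that] .
    qed
    then have "monomial ` (\<Union>J\<in>\<F>. A J) \<subseteq> \<Union>\<F>"
      by blast
    then show "ideal_gen (monomial ` (\<Union>J\<in>\<F>. A J)) \<subseteq> ideal_gen (\<Union>\<F>)"
      unfolding ideal_gen_def by (rule ideal.span_mono)
  qed
  then show "monomial_ideal (ideal_gen (\<Union>\<F>))" by (auto simp: monomial_ideal_def)
  have "exponents J = {u. \<exists>a\<in>A J. \<exists>w. u = a + w}" if "J \<in> \<F>" for J
  proof -
    have "exponents (ideal_gen (monomial ` A J) :: ('n, 'k) mpoly set) = {u. \<exists>a\<in>A J. \<exists>w. u = a + w}"
      by (rule Set.set_eqI) (simp only: mem_exponents_ideal_gen mem_Collect_eq)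
    then show ?thesis unfolding A[OF that] .
  qed
  then show "exponents (ideal_gen (\<Union>\<F>)) = (\<Union>J\<in>\<F>. exponents J)"
    unfolding eq by (intro Set.set_eqI) (simp add: mem_exponents_ideal_gen cong: bex_cong)
qed

section \<open>Digit decompositions and moving exponents in d-fixed ideals\<close>

lemma d_decomposition_exists:
  assumes "d_sequence ds"
  shows "\<exists>as. d_decomposition ds a as"
proof -
  define s where "s = length ds - 1"
  have len: "length ds = Suc s"
    using assms by (cases ds) (auto simp: d_sequence_def s_def)
  have dvd: "ds ! t dvd ds ! Suc t" if "t < s" for t
    using assms that len by (auto simp: d_sequence_def)
  have pos: "0 < ds ! t" if "t \<le> s" for t
  proof (cases t)
    case 0
    then show ?thesis using assms by (simp add: d_sequence_def)
  next
    case (Suc t')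
    then have "ds ! t' < ds ! t"
      using assms that len by (auto simp: d_sequence_def sorted_wrt_iff_nth_less)
    then show ?thesis by simp
  qed
  \<comment> \<open>the digits of \<open>a\<close> in the mixed-radix system with place values \<open>d\<^sub>t\<close>\<close>
  define c where "c t = (if t < s then a mod ds ! Suc t div ds ! t else a div ds ! t)" for t
  have partial: "(\<Sum>t<m. c t * ds ! t) = a mod ds ! m" if "m \<le> s" for m
    using that
  proof (induction m)
    case 0
    then show ?case using assms by (simp add: d_sequence_def)
  next
    case (Suc m)
    have "(\<Sum>t<Suc m. c t * ds ! t) = a mod ds ! m + (a mod ds ! Suc m div ds ! m) * ds ! m"
      using Suc by (simp add: c_def)
    also have "a mod ds ! m = a mod ds ! Suc m mod ds ! m"
      using dvd[of m] Suc.prems by (simp add: mod_mod_cancel)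
    finally show ?case by (simp only: mod_div_mult_eq)
  qed
  have "(\<Sum>t<length ds. c t * ds ! t) = a mod ds ! s + c s * ds ! s"
    using partial[of s] by (simp add: len)
  also have "c s = a div ds ! s" by (simp add: c_def)
  finally have "a = (\<Sum>t<length ds. c t * ds ! t)"
    by (simp only: mod_div_mult_eq)
  moreover have "c t < ds ! Suc t div ds ! t" if t: "t < s" for t
  proof -
    obtain q where q: "ds ! Suc t = ds ! t * q" using dvd[OF t] by blast
    have "a mod ds ! Suc t < ds ! Suc t" using pos[of "Suc t"] t by simp
    then have "a mod ds ! Suc t div ds ! t < q"
      unfolding q by (simp add: less_mult_imp_div_less mult.commute)
    then show ?thesis using t pos[of t] by (simp add: c_def q)
  qed
  ultimately have "d_decomposition ds a (map c [0..<length ds])"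
    unfolding d_decomposition_def by (simp add: len del: upt_Suc)
  then show ?thesis ..
qed

text \<open>This makes moving the whole exponent of a variable to an earlier variable an admissible
  move in a d-fixed ideal.\<close>

lemma le_d_refl: "d_sequence ds \<Longrightarrow> le_d ds a a"
  using d_decomposition_exists[of ds a] by (auto simp: le_d_def)

text \<open>The variables of \<open>B\<close> after \<open>k\<close> are emptied one by one. Each
  move changes only the emptied exponent and the one at \<open>k\<close>, so exponents before
  \<open>k\<close> stay and earlier zeros survive.\<close>

lemma d_fixed_collapse:
  fixes J :: "('n::{finite,linorder}, 'k::comm_ring_1) mpoly set"
  assumes "d_sequence ds" "d_fixed ds J" "u \<in> exponents J"
  obtains w where "w \<in> exponents J" "\<And>i. i < k \<Longrightarrow> Poly_Mapping.lookup w i = Poly_Mapping.lookup u i"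
    "\<And>i. k < i \<Longrightarrow> Poly_Mapping.lookup w i = 0" "mdeg w = mdeg u"
proof -
  have "\<exists>w\<in>exponents J. (\<forall>i<k. Poly_Mapping.lookup w i = Poly_Mapping.lookup u i) \<and>
      (\<forall>i\<in>B. k < i \<longrightarrow> Poly_Mapping.lookup w i = 0) \<and> mdeg w = mdeg u" for B :: "'n set"
    using finite[of B]
  proof (induction B rule: finite_induct)
    case empty
    then show ?case using assms by auto
  next
    case (insert i B)
    then obtain w where w: "w \<in> exponents J" "\<forall>i<k. Poly_Mapping.lookup w i = Poly_Mapping.lookup u i"
      "\<forall>i\<in>B. k < i \<longrightarrow> Poly_Mapping.lookup w i = 0" "mdeg w = mdeg u" by blast
    show ?case
    proof (cases "k < i")
      case False
      then show ?thesis using w by auto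
    next
      case True
      define t where "t = Poly_Mapping.lookup w i"
      define w' where "w' = w - Poly_Mapping.single i t + Poly_Mapping.single k t"
      have "w' \<in> exponents J"
        using assms(2) w(1) le_d_refl[OF assms(1), of t] True
        unfolding d_fixed_def w'_def t_def exponents_def by blast
      moreover have "mdeg w' = mdeg w"
      proof -
        have "mdeg (w - Poly_Mapping.single i t) + t = mdeg w"
          using minus_single_plus[of t w i] mdeg_add[of "w - Poly_Mapping.single i t" "Poly_Mapping.single i t"]
          by (simp add: t_def)
        then show ?thesis by (simp add: w'_def mdeg_add)
      qed
      moreover have "\<forall>l<k. Poly_Mapping.lookup w' l = Poly_Mapping.lookup u l"
        using w(2) True by (auto simp: w'_def lookup_add lookup_minus lookup_single when_def)
      moreover have "\<forall>l\<in>insert i B. k < l \<longrightarrow> Poly_Mapping.lookup w' l = 0"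
        using w(3) by (auto simp: w'_def t_def lookup_add lookup_minus lookup_single when_def)
      ultimately show ?thesis using w(4) by (intro bexI[of _ w']) auto
    qed
  qed
  from this[of UNIV] that show ?thesis by auto
qed

section \<open>Dickson's lemma and minimal generators\<close>

lemma nat_incseq_subseq:
  fixes s :: "nat \<Rightarrow> nat"
  obtains r where "strict_mono r" "incseq (s \<circ> r)"
proof -
  obtain f :: "nat \<Rightarrow> nat" where f: "strict_mono f" "monoseq (\<lambda>n. s (f n))"
    using seq_monosub by blast
  show ?thesis
  proof (cases "incseq (\<lambda>n. s (f n))")
    case True
    then show ?thesis using f that by (simp add: comp_def)
  next
    case False
    then have dec: "decseq (\<lambda>n. s (f n))" using f by (simp add: monoseq_iff)
    obtain N where N: "\<And>n. s (f N) \<le> s (f n)"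
      using ex_has_least_nat[of "\<lambda>_. True" _ "\<lambda>n. s (f n)"] by blast
    have "s (f (N + n)) = s (f N)" for n
      using N[of "N + n"] decseqD[OF dec, of N "N + n"] by simp
    moreover have "strict_mono (\<lambda>n. f (N + n))"
      using f(1) by (simp add: strict_mono_def)
    ultimately show ?thesis by (intro that[of "\<lambda>n. f (N + n)"]) (auto simp: incseq_def)
  qed
qed

text \<open>Passing to a subsequence once per variable makes every coordinate weakly increasing; its
  first two members are then comparable.\<close>

lemma dickson:
  fixes f :: "nat \<Rightarrow> ('n::finite \<Rightarrow>\<^sub>0 nat)"
  shows "\<exists>m n. m < n \<and> (\<forall>i. Poly_Mapping.lookup (f m) i \<le> Poly_Mapping.lookup (f n) i)"
proof -
  have "\<exists>r. strict_mono r \<and> (\<forall>i\<in>B. incseq (\<lambda>n. Poly_Mapping.lookup (f (r n)) i))" for B :: "'n set"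
    using finite[of B]
  proof (induction B rule: finite_induct)
    case empty
    then show ?case by (intro exI[of _ "\<lambda>n. n"]) (auto simp: strict_mono_def)
  next
    case (insert i B)
    then obtain r where r: "strict_mono r" "\<forall>i\<in>B. incseq (\<lambda>n. Poly_Mapping.lookup (f (r n)) i)" by blast
    obtain q where q: "strict_mono q" "incseq ((\<lambda>n. Poly_Mapping.lookup (f (r n)) i) \<circ> q)"
      by (rule nat_incseq_subseq)
    have "q m \<le> q n" if "m \<le> n" for m n
      using q(1) that by (simp add: strict_mono_less_eq)
    then have "\<forall>i\<in>insert i B. incseq (\<lambda>n. Poly_Mapping.lookup (f ((r \<circ> q) n)) i)"
      using r(2) q(2) by (auto simp: incseq_def)
    then show ?case using r(1) q(1) strict_mono_o by blast
  qed
  from this[of UNIV] obtain r where r: "strict_mono r" "\<And>i. incseq (\<lambda>n. Poly_Mapping.lookup (f (r n)) i)"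
    by blast
  have "r 0 < r 1" using r(1) by (simp add: strict_mono_def)
  moreover have "Poly_Mapping.lookup (f (r 0)) i \<le> Poly_Mapping.lookup (f (r 1)) i" for i
    using incseqD[OF r(2), of 0 1] by simp
  ultimately show ?thesis by blast
qed

text \<open>Infinitely many minimal generators would include two comparable ones. Finiteness makes
  the \<open>Max\<close> in \<open>ideal_deg\<close> an upper bound for the degrees of the
  generators.\<close>

lemma finite_min_gens: "finite (min_gens (I :: ('n::finite, 'k::comm_ring_1) mpoly set))"
proof (rule ccontr)
  assume "infinite (min_gens I)"
  then obtain f :: "nat \<Rightarrow> _" where f: "inj f" "range f \<subseteq> min_gens I"
    using infinite_countable_subset by blast
  obtain m n where mn: "m < n" "\<And>i. Poly_Mapping.lookup (f m) i \<le> Poly_Mapping.lookup (f n) i"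
    using dickson by blast
  obtain w where w: "f n = f m + w"
    using mn(2) by (rule exponent_le_imp_add)
  have "f n \<in> min_gens I" "f m \<in> min_gens I" using f(2) by auto
  then have "w = 0" using w unfolding min_gens_def by blast
  then show False using w f(1) mn(1) by (auto dest: injD)
qed

lemma min_gens_divides:
  fixes I :: "('n::finite, 'k::comm_ring_1) mpoly set"
  assumes "u \<in> exponents I"
  obtains w z where "u = w + z" "w \<in> min_gens I"
proof -
  have "\<exists>w z. u = w + z \<and> w \<in> min_gens I"
    using assms
  proof (induction "mdeg u" arbitrary: u rule: less_induct)
    case less
    show ?case
    proof (cases "u \<in> min_gens I")
      case True
      then show ?thesis by (metis add.right_neutral)
    next
      case False
      then obtain v w where vw: "v \<in> exponents I" "u = v + w" "w \<noteq> 0"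
        using less.prems by (auto simp: min_gens_def exponents_def)
      then have "mdeg w \<noteq> 0" by (simp add: mdeg_eq_0_iff)
      then have "mdeg v < mdeg u" using vw by (simp add: mdeg_add)
      then show ?thesis using less.hyps vw by (metis add.assoc)
    qed
  qed
  then show ?thesis using that by blast
qed

lemma exponents_generator:
  fixes I :: "('n::finite, 'k::comm_ring_1) mpoly set"
  assumes "u \<in> exponents I"
  obtains w z where "u = w + z" "w \<in> exponents I" "mdeg w \<le> ideal_deg I"
proof -
  obtain w z where "u = w + z" "w \<in> min_gens I" using assms by (rule min_gens_divides)
  then show ?thesis
    using that finite_min_gens[of I] by (auto simp: ideal_deg_def min_gens_def exponents_def)
qed

section \<open>The exchange property and stability of truncations\<close>

lemma pigeonhole_exponent:
  fixes u :: "'n::finite \<Rightarrow>\<^sub>0 nat"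
  assumes "int (mdeg u) \<ge> int CARD('n) * (int d - 1) + 1"
  obtains k where "d \<le> Poly_Mapping.lookup u k"
proof (rule ccontr)
  assume "\<not> thesis"
  then have "\<not> d \<le> Poly_Mapping.lookup u k" for k
    using that by blast
  \<comment> \<open>The bound is taken in \<open>int\<close>, so that \<open>d - 1\<close> is not
    cut off at 0.\<close>
  then have *: "int (Poly_Mapping.lookup u k) \<le> int d - 1" for k
    by (simp add: not_le)
  have "int (mdeg u) \<le> (\<Sum>k\<in>(UNIV::'n set). int d - 1)"
    unfolding mdeg_def of_nat_sum by (intro sum_mono *)
  then show False using assms by simp
qed

lemma D_fixed_monomial_ideal: "D_fixed I \<Longrightarrow> monomial_ideal I"
  unfolding D_fixed_def d_fixed_def by (metis monomial_ideal_sum(1))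

text \<open>The pigeonhole principle is applied to the exchanged monomial \<open>u'\<close>, since
  the collapsed generator has to divide \<open>u'\<close> rather than \<open>u\<close>. For
  \<open>d > 0\<close> its variable \<open>k\<close> cannot lie after \<open>m\<close>, where
  \<open>u'\<close> has no exponents.\<close>

lemma D_fixed_exchange:
  fixes I :: "('n::{finite,linorder}, 'k::comm_ring_1) mpoly set"
  assumes "D_fixed I" "u \<in> exponents I" "i < m" "0 < Poly_Mapping.lookup u m"
    and above: "\<And>l. m < l \<Longrightarrow> Poly_Mapping.lookup u l = 0"
    and deg: "int (mdeg u) \<ge> int CARD('n) * (int (ideal_deg I) - 1) + 1"
  shows "u - Poly_Mapping.single m 1 + Poly_Mapping.single i 1 \<in> exponents I"
proof -
  define d where "d = ideal_deg I"
  define u' where "u' = u - Poly_Mapping.single m 1 + Poly_Mapping.single i 1"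
  have mono: "monomial_ideal I" using assms(1) by (rule D_fixed_monomial_ideal)
  have mdeg: "mdeg u' = mdeg u"
  proof -
    have "u - Poly_Mapping.single m 1 + Poly_Mapping.single m 1 = u"
      using assms(4) by (intro minus_single_plus) simp
    then show ?thesis
      unfolding u'_def by (metis mdeg_add mdeg_single)
  qed
  have lu': "Poly_Mapping.lookup u l \<le> Poly_Mapping.lookup u' l" if "l < m" for l
    using that by (auto simp: u'_def lookup_add lookup_minus lookup_single when_def)
  have above': "Poly_Mapping.lookup u' l = 0" if "m < l" for l
    using above[OF that] that assms(3) by (auto simp: u'_def lookup_add lookup_minus lookup_single when_def)
  obtain k where k: "d \<le> Poly_Mapping.lookup u' k"
    using pigeonhole_exponent[of d u'] deg by (auto simp: mdeg d_def)
  obtain w z where w: "u = w + z" "w \<in> exponents I" "mdeg w \<le> d"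
    using assms(2) unfolding d_def by (rule exponents_generator)
  show ?thesis
  proof (cases "d = 0")
    \<comment> \<open>A generator of degree 0 makes \<open>I\<close> the whole ring.\<close>
    case True
    then have "0 \<in> exponents I" using w by (simp add: mdeg_eq_0_iff)
    then show ?thesis using monomial_ideal_eq_UNIV[OF mono] by simp
  next
    case False
    then have "k \<le> m" using above'[of k] k by force
    obtain \<F> where \<F>: "\<And>J. J \<in> \<F> \<Longrightarrow> \<exists>ds. d_sequence ds \<and> d_fixed ds J" "I = ideal_gen (\<Union>\<F>)"
      using assms(1) unfolding D_fixed_def by blast
    have ex: "exponents I = (\<Union>J\<in>\<F>. exponents J)"
      unfolding \<F>(2) using \<F>(1) by (intro monomial_ideal_sum(2)) (auto simp: d_fixed_def)
    then obtain J where J: "J \<in> \<F>" "w \<in> exponents J" using w by blast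
    then obtain ds where ds: "d_sequence ds" "d_fixed ds J" using \<F>(1) by blast
    obtain w' where w': "w' \<in> exponents J" "\<And>i. i < k \<Longrightarrow> Poly_Mapping.lookup w' i = Poly_Mapping.lookup w i"
      "\<And>i. k < i \<Longrightarrow> Poly_Mapping.lookup w' i = 0" "mdeg w' = mdeg w"
      using d_fixed_collapse[OF ds J(2), of k] by blast
    \<comment> \<open>Before \<open>k\<close> the exponents of \<open>w'\<close> are those of
      \<open>w\<close>, and \<open>u'\<close> is smaller than \<open>u\<close> at most at
      \<open>m\<close>, which is not before \<open>k\<close>. At \<open>k\<close> even the whole
      degree of \<open>w'\<close> is at most \<open>d\<close>. After \<open>k\<close> nothing is
      left.\<close>
    have "Poly_Mapping.lookup w' l \<le> Poly_Mapping.lookup u' l" for l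
    proof (cases l k rule: linorder_cases)
      case less
      then have "Poly_Mapping.lookup w' l \<le> Poly_Mapping.lookup u l"
        using w'(2)[of l] w(1) by (simp add: lookup_add)
      then show ?thesis using lu'[of l] less \<open>k \<le> m\<close> by (meson le_trans less_le_trans)
    next
      case equal
      have "Poly_Mapping.lookup w' k \<le> mdeg w'" by (rule lookup_le_mdeg)
      then show ?thesis using equal w'(4) w(3) k by simp
    next
      case greater
      then show ?thesis using w'(3) by simp
    qed
    then obtain y where "u' = w' + y" by (rule exponent_le_imp_add)
    moreover have "w' \<in> exponents I" using w'(1) J(1) ex by blast
    ultimately show ?thesis
      using monomial_ideal_exponents_add[OF mono] by (simp add: u'_def)
  qed
qed

text \<open>The truncation keeps exactly the monomials of \<open>I\<close> of degree at least
  \<open>e\<close>, and the exchange preserves degrees, so \<open>D_fixed_exchange\<close> applies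
  with \<open>m\<close> the last variable of \<open>u\<close>.\<close>

lemma D_fixed_truncation_stable:
  fixes I :: "('n::{finite,linorder}, 'k::comm_ring_1) mpoly set"
  assumes "D_fixed I" "e \<ge> int CARD('n) * (int (ideal_deg I) - 1) + 1"
  shows "stable_ideal (truncation_ge e I)"
proof -
  have mono: "monomial_ideal I" using assms(1) by (rule D_fixed_monomial_ideal)
  have "u \<in> exponents (truncation_ge e I) \<longleftrightarrow> u \<in> exponents I \<and> int (mdeg u) \<ge> e" for u
    unfolding truncation_ge_def mem_exponents_ideal_gen monomial_mem_iff
    by (auto simp: mdeg_add intro: monomial_ideal_exponents_add[OF mono])
  note mem = this
  show ?thesis
    unfolding stable_ideal_def Let_def monomial_mem_iff mem
  proof (intro conjI allI impI; (elim conjE)?)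
    show "monomial_ideal (truncation_ge e I)"
      unfolding truncation_ge_def monomial_ideal_def by blast
  next
    fix u i assume u: "u \<in> exponents I" "e \<le> int (mdeg u)" "u \<noteq> 0" "i < Max (Poly_Mapping.keys u)"
    let ?m = "Max (Poly_Mapping.keys u)"
    have "?m \<in> Poly_Mapping.keys u" using u(3) by (intro Max_in) auto
    then have pos: "0 < Poly_Mapping.lookup u ?m" by (simp add: in_keys_iff)
    have "Poly_Mapping.lookup u l = 0" if "?m < l" for l
      using that by (metis Max_ge finite_keys in_keys_iff leD)
    then show "u - Poly_Mapping.single ?m 1 + Poly_Mapping.single i 1 \<in> exponents I"
      using D_fixed_exchange[OF assms(1) u(1,4) pos] assms(2) u(2) by force
    have "u - Poly_Mapping.single ?m 1 + Poly_Mapping.single ?m 1 = u"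
      using pos by (intro minus_single_plus) simp
    then show "e \<le> int (mdeg (u - Poly_Mapping.single ?m 1 + Poly_Mapping.single i 1))"
      using u(2) by (metis mdeg_add mdeg_single)
  qed
qed

text \<open>This is the monomial form of the agreement of \<open>(X) I\<close> with the intersection
  of \<open>I\<close> and \<open>(X)\<close> in large degrees. The degree bound is strict, so that
  the exchange is still available after one variable has been split off.\<close>

lemma D_fixed_divide_large:
  fixes I :: "('n::{finite,linorder}, 'k::comm_ring_1) mpoly set"
  assumes "D_fixed I" "I \<noteq> UNIV" "u \<in> exponents I"
    and deg: "int (mdeg u) > int CARD('n) * (int (ideal_deg I) - 1) + 1"
    and X: "\<And>k l. k \<in> X \<Longrightarrow> k \<le> l \<Longrightarrow> l \<in> X" "\<exists>k\<in>X. 0 < Poly_Mapping.lookup u k"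
  shows "\<exists>k\<in>X. \<exists>v\<in>exponents I. u = v + Poly_Mapping.single k 1"
proof -
  have mono: "monomial_ideal I" using assms(1) by (rule D_fixed_monomial_ideal)
  obtain w z where w: "u = w + z" "w \<in> exponents I" "mdeg w \<le> ideal_deg I"
    using assms(3) by (rule exponents_generator)
  have "w \<noteq> 0" using w(2) monomial_ideal_eq_UNIV[OF mono] assms(2) by blast
  then have d: "ideal_deg I \<ge> 1" using w(3) mdeg_eq_0_iff[of w] by linarith
  \<comment> \<open>Hence \<open>deg I\<close> is at most \<open>n (deg I - 1) + 1\<close>, and the
    generator \<open>w\<close> is a proper divisor of \<open>u\<close>.\<close>
  have "int (ideal_deg I) - 1 \<le> int CARD('n) * (int (ideal_deg I) - 1)"
    using d by (simp add: mult_le_cancel_right1 Suc_le_eq)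
  then have "mdeg w < mdeg u" using w(3) deg by linarith
  then have "z \<noteq> 0" using w(1) by auto
  then obtain y where y: "y \<in> Poly_Mapping.keys z" by (metis all_not_in_conv keys_eq_empty)
  then have zy: "z = z - Poly_Mapping.single y 1 + Poly_Mapping.single y 1"
    by (intro minus_single_plus[symmetric]) (auto simp: in_keys_iff)
  define v where "v = w + (z - Poly_Mapping.single y 1)"
  have v: "v \<in> exponents I" "u = v + Poly_Mapping.single y 1"
    using monomial_ideal_exponents_add[OF mono w(2)] zy w(1) by (auto simp: v_def add.assoc)
  define m where "m = Max (Poly_Mapping.keys u)"
  have ne: "Poly_Mapping.keys u \<noteq> {}" using X(2) by (auto simp: in_keys_iff)
  then have m: "m \<in> Poly_Mapping.keys u" unfolding m_def by (intro Max_in) auto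
  have above: "Poly_Mapping.lookup u l = 0" if "m < l" for l
    using that unfolding m_def by (metis Max_ge finite_keys in_keys_iff leD)
  \<comment> \<open>Some variable of \<open>u\<close> lies in the final segment \<open>X\<close>,
    and \<open>m\<close> is not before it.\<close>
  have "m \<in> X"
    using X(2) above X(1) by (metis leI less_irrefl)
  show ?thesis
  proof (cases "y = m")
    case True
    then show ?thesis using v \<open>m \<in> X\<close> by blast
  next
    case False
    have "y \<le> m" using above[of y] v(2) by (force simp: lookup_add not_less[symmetric])
    then have "y < m" using False by simp
    have vm: "0 < Poly_Mapping.lookup v m"
      using m v(2) False by (auto simp: in_keys_iff lookup_add lookup_single when_def)
    \<comment> \<open>Exchanging \<open>m\<close> for \<open>y\<close> in \<open>v\<close> stays in
      \<open>I\<close>, and multiplying by the variable \<open>m\<close> then restores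
      \<open>u\<close>.\<close>
    have "v - Poly_Mapping.single m 1 + Poly_Mapping.single y 1 \<in> exponents I"
    proof (rule D_fixed_exchange[OF assms(1) v(1) \<open>y < m\<close> vm])
      show "Poly_Mapping.lookup v l = 0" if "m < l" for l
        using above[OF that] v(2) by (simp add: lookup_add)
      show "int CARD('n) * (int (ideal_deg I) - 1) + 1 \<le> int (mdeg v)"
        using deg v(2) by (simp add: mdeg_add)
    qed
    moreover have "u = (v - Poly_Mapping.single m 1 + Poly_Mapping.single y 1) + Poly_Mapping.single m 1"
    proof -
      have "v - Poly_Mapping.single m 1 + Poly_Mapping.single m 1 = v"
        using vm by (intro minus_single_plus) simp
      then show ?thesis unfolding v(2) by (metis add.assoc add.commute)
    qed
    ultimately show ?thesis using \<open>m \<in> X\<close> by blast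
  qed
qed

section \<open>Ideals generated by variables, described by the monomials they contain\<close>

definition var_ideal :: "'n set \<Rightarrow> ('n, 'k::comm_ring_1) mpoly set" where
  "var_ideal X = {p. \<forall>u\<in>Poly_Mapping.keys p. \<exists>k\<in>X. 0 < Poly_Mapping.lookup u k}"

lemma var_ideal_0 [simp]: "0 \<in> var_ideal X"
  by (simp add: var_ideal_def)

lemma var_ideal_empty: "p \<in> var_ideal {} \<longleftrightarrow> p = 0"
  unfolding var_ideal_def using keys_eq_empty[of p] by auto

lemma var_ideal_add: "p \<in> var_ideal X \<Longrightarrow> q \<in> var_ideal X \<Longrightarrow> p + q \<in> var_ideal X"
  using keys_add[of p q] unfolding var_ideal_def by blast

lemma var_ideal_mult:
  assumes "p \<in> var_ideal X"
  shows "q * p \<in> var_ideal X"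
  unfolding var_ideal_def mem_Collect_eq
proof
  fix u assume "u \<in> Poly_Mapping.keys (q * p)"
  then obtain a b where u: "u = a + b" "b \<in> Poly_Mapping.keys p"
    using keys_mult[of q p] by blast
  then obtain k where "k \<in> X" "0 < Poly_Mapping.lookup b k"
    using assms unfolding var_ideal_def by blast
  then show "\<exists>k\<in>X. 0 < Poly_Mapping.lookup u k"
    by (intro bexI[of _ k]) (simp_all add: u(1) lookup_add)
qed

lemma var_ideal_uminus: "p \<in> var_ideal X \<Longrightarrow> - p \<in> var_ideal X"
  by (simp add: var_ideal_def)

lemma var_ideal_sum: "(\<And>x. x \<in> A \<Longrightarrow> f x \<in> var_ideal X) \<Longrightarrow> sum f A \<in> var_ideal X"
  by (induction A rule: infinite_finite_induct) (auto intro: var_ideal_add)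

lemma var_ideal_mono: "p \<in> var_ideal X \<Longrightarrow> X \<subseteq> Y \<Longrightarrow> p \<in> var_ideal Y"
  unfolding var_ideal_def by blast

lemma single_mem_var_ideal: "k \<in> X \<Longrightarrow> Poly_Mapping.single (Poly_Mapping.single k 1) c \<in> var_ideal X"
  by (cases "c = 0") (auto simp: var_ideal_def intro!: bexI[of _ k])

lemma lookup_monomial_mult:
  fixes p :: "('n, 'k::comm_ring_1) mpoly"
  shows "Poly_Mapping.lookup (monomial s * p) (s + u) = Poly_Mapping.lookup p u"
proof -
  have "monomial s * p =
      (\<Sum>v\<in>Poly_Mapping.keys p. Poly_Mapping.single (s + v) (Poly_Mapping.lookup p v))"
    by (subst (1) poly_mapping_sum_single[of p, symmetric])
      (simp add: sum_distrib_left monomial_def mult_single)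
  then have "Poly_Mapping.lookup (monomial s * p) (s + u) =
      (\<Sum>v\<in>Poly_Mapping.keys p. Poly_Mapping.lookup (Poly_Mapping.single v (Poly_Mapping.lookup p v)) u)"
    by (simp add: lookup_sum lookup_single)
  also have "\<dots> = Poly_Mapping.lookup p u"
    by (simp add: lookup_sum[symmetric] poly_mapping_sum_single)
  finally show ?thesis .
qed

text \<open>A variable outside \<open>X\<close> is a nonzerodivisor modulo \<open>(X)\<close>:
  multiplying by it neither merges monomials nor adds a factor from \<open>X\<close>.\<close>

lemma var_ideal_cancel:
  fixes p :: "('n, 'k::comm_ring_1) mpoly"
  assumes "monomial (Poly_Mapping.single k 1) * p \<in> var_ideal X" "k \<notin> X"
  shows "p \<in> var_ideal X"
  unfolding var_ideal_def mem_Collect_eq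
proof
  fix u assume "u \<in> Poly_Mapping.keys p"
  then have "Poly_Mapping.single k 1 + u \<in> Poly_Mapping.keys (monomial (Poly_Mapping.single k 1) * p)"
    by (simp add: in_keys_iff lookup_monomial_mult)
  then obtain l where "l \<in> X" "0 < Poly_Mapping.lookup (Poly_Mapping.single k 1 + u) l"
    using assms(1) unfolding var_ideal_def by blast
  then show "\<exists>l\<in>X. 0 < Poly_Mapping.lookup u l"
    using assms(2) by (intro bexI[of _ l]) (auto simp: lookup_add lookup_single when_def split: if_splits)
qed

section \<open>Homogeneous polynomials and constant terms\<close>

lemma homogeneous_0 [simp]: "homogeneous d 0"
  by (simp add: homogeneous_def)

lemma homogeneous_add: "homogeneous d p \<Longrightarrow> homogeneous d q \<Longrightarrow> homogeneous d (p + q)"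
  using keys_add[of p q] unfolding homogeneous_def by blast

lemma homogeneous_diff: "homogeneous d p \<Longrightarrow> homogeneous d q \<Longrightarrow> homogeneous d (p - q)"
  using keys_diff[of p q] unfolding homogeneous_def by blast

lemma homogeneous_mult:
  assumes "homogeneous a p" "homogeneous b q"
  shows "homogeneous (a + b) (p * q)"
  unfolding homogeneous_def
proof
  fix u assume "u \<in> Poly_Mapping.keys (p * q)"
  then obtain v w where "u = v + w" "v \<in> Poly_Mapping.keys p" "w \<in> Poly_Mapping.keys q"
    using keys_mult[of p q] by blast
  then show "int (mdeg u) = a + b"
    using assms by (auto simp: homogeneous_def mdeg_add)
qed

lemma homogeneous_sum: "(\<And>x. x \<in> A \<Longrightarrow> homogeneous d (f x)) \<Longrightarrow> homogeneous d (sum f A)"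
  by (induction A rule: infinite_finite_induct) (auto intro: homogeneous_add)

text \<open>The terms divisible by the variable \<open>k\<close>, divided by it, make up
  \<open>b\<close>; each remaining term must involve a variable of \<open>X\<close>.\<close>

lemma var_ideal_insert_split:
  fixes p :: "('n::finite, 'k::comm_ring_1) mpoly"
  assumes "p \<in> var_ideal (insert k X)" "homogeneous d p"
  shows "\<exists>b. homogeneous (d - 1) b \<and> p - monomial (Poly_Mapping.single k 1) * b \<in> var_ideal X"
proof -
  define U where "U = {u \<in> Poly_Mapping.keys p. 0 < Poly_Mapping.lookup u k}"
  define x where "x = Poly_Mapping.single k (1::nat)"
  define b where "b = (\<Sum>u\<in>U. Poly_Mapping.single (u - x) (Poly_Mapping.lookup p u))"
  have U: "u - x + x = u" if "u \<in> U" for u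
    unfolding x_def using that by (intro minus_single_plus) (auto simp: U_def)
  have "homogeneous (d - 1) b"
    unfolding b_def
  proof (rule homogeneous_sum)
    fix u assume u: "u \<in> U"
    have "mdeg (u - x) + 1 = mdeg u"
      using mdeg_add[of "u - x" x] unfolding U[OF u] by (simp add: x_def)
    moreover have "int (mdeg u) = d"
      using u assms(2) by (auto simp: U_def homogeneous_def)
    ultimately show "homogeneous (d - 1) (Poly_Mapping.single (u - x) (Poly_Mapping.lookup p u))"
      by (auto simp: homogeneous_def)
  qed
  moreover have "p - monomial x * b \<in> var_ideal X"
  proof -
    have "monomial x * b = (\<Sum>u\<in>U. Poly_Mapping.single u (Poly_Mapping.lookup p u))"
      unfolding b_def sum_distrib_left monomial_def mult_single
      using U by (intro sum.cong) (simp_all add: add.commute)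
    moreover have "U \<subseteq> Poly_Mapping.keys p" by (auto simp: U_def)
    ultimately have "p - monomial x * b =
        (\<Sum>u\<in>Poly_Mapping.keys p - U. Poly_Mapping.single u (Poly_Mapping.lookup p u))"
      using sum.subset_diff[of U "Poly_Mapping.keys p" "\<lambda>u. Poly_Mapping.single u (Poly_Mapping.lookup p u)"]
      by (simp add: poly_mapping_sum_single algebra_simps)
    also have "\<dots> \<in> var_ideal X"
    proof (rule var_ideal_sum)
      fix u assume "u \<in> Poly_Mapping.keys p - U"
      then show "Poly_Mapping.single u (Poly_Mapping.lookup p u) \<in> var_ideal X"
        using assms(1) by (auto simp: U_def var_ideal_def)
    qed
    finally show ?thesis .
  qed
  ultimately show ?thesis unfolding x_def by blast
qed

text \<open>Homogeneous components serve to replace preimages under graded maps by homogeneous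
  ones.\<close>

definition hcomp :: "int \<Rightarrow> ('n::finite, 'k::comm_ring_1) mpoly \<Rightarrow> ('n, 'k) mpoly" where
  "hcomp d p = (\<Sum>u\<in>{u\<in>Poly_Mapping.keys p. int (mdeg u) = d}. Poly_Mapping.single u (Poly_Mapping.lookup p u))"

lemma lookup_hcomp:
  "Poly_Mapping.lookup (hcomp d p) v = (if int (mdeg v) = d then Poly_Mapping.lookup p v else 0)"
proof -
  let ?U = "{u \<in> Poly_Mapping.keys p. int (mdeg u) = d}"
  have "finite ?U" by simp
  have "Poly_Mapping.lookup (hcomp d p) v = (\<Sum>u\<in>?U. if u = v then Poly_Mapping.lookup p u else 0)"
    unfolding hcomp_def lookup_sum by (intro sum.cong) (auto simp: lookup_single when_def)
  also have "\<dots> = (if v \<in> ?U then Poly_Mapping.lookup p v else 0)"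
    using \<open>finite ?U\<close> by (simp add: sum.delta)
  finally show ?thesis by (simp add: in_keys_iff)
qed

lemma homogeneous_hcomp: "homogeneous d (hcomp d p)"
  by (auto simp: homogeneous_def in_keys_iff lookup_hcomp split: if_splits)

lemma hcomp_homogeneous: "homogeneous d p \<Longrightarrow> hcomp d p = p"
  by (intro poly_mapping_eqI) (auto simp: homogeneous_def in_keys_iff lookup_hcomp)

lemma hcomp_diff: "hcomp d (p - q) = hcomp d p - hcomp d q"
  by (intro poly_mapping_eqI) (simp add: lookup_hcomp lookup_minus)

lemma hcomp_sum: "hcomp d (sum f A) = (\<Sum>x\<in>A. hcomp d (f x))"
  by (intro poly_mapping_eqI) (simp add: lookup_hcomp lookup_sum)

lemma hcomp_var_ideal: "p \<in> var_ideal X \<Longrightarrow> hcomp d p \<in> var_ideal X"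
  by (auto simp: var_ideal_def in_keys_iff lookup_hcomp split: if_splits)

text \<open>Once the part of degree \<open>b\<close> is removed from \<open>q\<close>, the product
  with \<open>p\<close> has no terms of degree \<open>a + b\<close>.\<close>

lemma hcomp_mult:
  assumes "homogeneous a p"
  shows "hcomp (a + b) (p * q) = p * hcomp b q"
proof -
  have "hcomp (a + b) (p * (q - hcomp b q)) = 0"
  proof (rule poly_mapping_eqI)
    fix u
    have "Poly_Mapping.lookup (p * (q - hcomp b q)) u = 0" if "int (mdeg u) = a + b"
    proof (rule ccontr)
      assume "Poly_Mapping.lookup (p * (q - hcomp b q)) u \<noteq> 0"
      then have "u \<in> Poly_Mapping.keys (p * (q - hcomp b q))" by (simp add: in_keys_iff)
      then obtain v w where u: "u = v + w" "v \<in> Poly_Mapping.keys p" "w \<in> Poly_Mapping.keys (q - hcomp b q)"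
        using keys_mult[of p "q - hcomp b q"] by blast
      then have "int (mdeg v) = a" using assms by (simp add: homogeneous_def)
      moreover have "int (mdeg w) \<noteq> b"
        using u(3) by (auto simp: in_keys_iff lookup_minus lookup_hcomp)
      ultimately show False using that u(1) by (simp add: mdeg_add)
    qed
    then show "Poly_Mapping.lookup (hcomp (a + b) (p * (q - hcomp b q))) u = Poly_Mapping.lookup 0 u"
      by (simp add: lookup_hcomp)
  qed
  then have "hcomp (a + b) (p * q) = hcomp (a + b) (p * hcomp b q)"
    by (simp add: right_diff_distrib hcomp_diff)
  also have "\<dots> = p * hcomp b q"
    by (intro hcomp_homogeneous homogeneous_mult assms homogeneous_hcomp)
  finally show ?thesis .
qed

text \<open>This identifies reduction modulo all variables with passing to constant terms, as in
  \<open>tensor_diff\<close>.\<close>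

lemma mem_var_ideal_UNIV_iff:
  fixes p :: "('n, 'k::comm_ring_1) mpoly"
  shows "p \<in> var_ideal UNIV \<longleftrightarrow> Poly_Mapping.lookup p 0 = 0"
proof -
  have *: "(\<exists>k. 0 < Poly_Mapping.lookup u k) \<longleftrightarrow> u \<noteq> 0" for u :: "'n \<Rightarrow>\<^sub>0 nat"
    by (auto simp: keys_eq_empty[symmetric] in_keys_iff set_eq_iff simp del: keys_eq_empty)
  have "p \<in> var_ideal UNIV \<longleftrightarrow> 0 \<notin> Poly_Mapping.keys p"
    by (simp add: var_ideal_def *) blast
  then show ?thesis by (simp add: in_keys_iff)
qed

text \<open>Modulo all variables, both factors may be replaced by their constant terms.\<close>

lemma lookup_mult_0:
  fixes p q :: "('n, 'k::comm_ring_1) mpoly"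
  shows "Poly_Mapping.lookup (p * q) 0 = Poly_Mapping.lookup p 0 * Poly_Mapping.lookup q 0"
proof -
  define c d where "c = Poly_Mapping.single (0 :: 'n \<Rightarrow>\<^sub>0 nat) (Poly_Mapping.lookup p 0)"
    and "d = Poly_Mapping.single (0 :: 'n \<Rightarrow>\<^sub>0 nat) (Poly_Mapping.lookup q 0)"
  have "p - c \<in> var_ideal UNIV" "q - d \<in> var_ideal UNIV"
    by (simp_all add: mem_var_ideal_UNIV_iff c_def d_def lookup_minus)
  then have "q * (p - c) + c * (q - d) \<in> var_ideal UNIV"
    by (intro var_ideal_add var_ideal_mult)
  then have "p * q - c * d \<in> var_ideal UNIV"
    by (simp add: algebra_simps)
  then show ?thesis
    by (simp add: mem_var_ideal_UNIV_iff c_def d_def lookup_minus mult_single)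
qed

section \<open>Matrices acting on coordinate functions, free of carrier conditions\<close>

definition mat_app :: "'a::comm_ring_1 mat \<Rightarrow> (nat \<Rightarrow> 'a) \<Rightarrow> nat \<Rightarrow> 'a" where
  "mat_app A v k = (\<Sum>l<dim_col A. A $$ (k, l) * v l)"

lemma mult_mat_vec_mat_app:
  "k < dim_row A \<Longrightarrow> v \<in> carrier_vec (dim_col A) \<Longrightarrow> (A *\<^sub>v v) $ k = mat_app A (\<lambda>l. v $ l) k"
  by (auto simp: mat_app_def scalar_prod_def lessThan_atLeast0 intro!: sum.cong)

lemma mat_app_cong: "(\<And>l. l < dim_col A \<Longrightarrow> v l = w l) \<Longrightarrow> mat_app A v k = mat_app A w k"
  by (simp add: mat_app_def)

lemma mat_app_diff: "mat_app A (\<lambda>l. v l - w l) k = mat_app A v k - mat_app A w k"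
  by (simp add: mat_app_def sum_subtractf right_diff_distrib)

lemma mat_app_scale: "mat_app A (\<lambda>l. c * v l) k = c * mat_app A v k"
  unfolding mat_app_def sum_distrib_left by (intro sum.cong refl mult.left_commute)

lemma mat_app_sum: "mat_app A (\<lambda>l. \<Sum>x\<in>B. v x l) k = (\<Sum>x\<in>B. mat_app A (v x) k)"
  unfolding mat_app_def sum_distrib_left by (rule sum.swap)

lemma mat_app_var_ideal:
  "(\<And>l. l < dim_col A \<Longrightarrow> v l \<in> var_ideal X) \<Longrightarrow> mat_app A v k \<in> var_ideal X"
  unfolding mat_app_def by (intro var_ideal_sum var_ideal_mult) simp

section \<open>Exactness and grading of a free resolution\<close>

locale resolution =
  fixes I :: "('n::{finite,linorder}, 'k::comm_ring_1) mpoly set" and g D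
  assumes res: "graded_free_resolution I g D"
begin

text \<open>The degrees of the basis of the target of \<open>D i\<close>, which is \<open>S\<close> itself for \<open>i = 0\<close>.\<close>

definition row_deg :: "nat \<Rightarrow> nat \<Rightarrow> int" where
  "row_deg i k = (case i of 0 \<Rightarrow> 0 | Suc i' \<Rightarrow> g i' k)"

text \<open>These are the coordinates of a homogeneous element of degree \<open>j\<close> in the
  \<open>i\<close>-th free module. Where \<open>j - g i l\<close> is negative, the coefficient is
  forced to vanish.\<close>

definition homogeneous_elem :: "nat \<Rightarrow> int \<Rightarrow> (nat \<Rightarrow> ('n, 'k) mpoly) \<Rightarrow> bool" where
  "homogeneous_elem i j v \<longleftrightarrow> (\<forall>l<dim_col (D i). homogeneous (j - g i l) (v l))"

lemma dim_row_0: "dim_row (D 0) = 1"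
  and dim_row_Suc: "dim_row (D (Suc i)) = dim_col (D i)"
  using res by (auto simp: graded_free_resolution_def)

lemma homogeneous_entry:
  "k < dim_row (D i) \<Longrightarrow> l < dim_col (D i) \<Longrightarrow> homogeneous (g i l - row_deg i k) (D i $$ (k, l))"
  using res by (cases i) (auto simp: graded_free_resolution_def row_deg_def)

lemma augmentation_image:
  "(\<lambda>v. D 0 *\<^sub>v v) ` carrier_vec (dim_col (D 0)) = {y \<in> carrier_vec 1. y $ 0 \<in> I}"
  using res by (simp add: graded_free_resolution_def)

lemma image_eq_kernel:
  "(\<lambda>v. D (Suc i) *\<^sub>v v) ` carrier_vec (dim_col (D (Suc i))) = mat_kernel (D i)"
  using res by (simp add: graded_free_resolution_def)

lemma augmentation_in_ideal: "mat_app (D 0) v 0 \<in> I"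
proof -
  define u where "u = vec (dim_col (D 0)) v"
  have u: "u \<in> carrier_vec (dim_col (D 0))" by (simp add: u_def)
  have "D 0 *\<^sub>v u \<in> {y \<in> carrier_vec 1. y $ 0 \<in> I}"
    using u augmentation_image by blast
  then have "(D 0 *\<^sub>v u) $ 0 \<in> I" by blast
  moreover have "(D 0 *\<^sub>v u) $ 0 = mat_app (D 0) (\<lambda>l. u $ l) 0"
    using u by (intro mult_mat_vec_mat_app) (simp_all add: dim_row_0)
  moreover have "\<dots> = mat_app (D 0) v 0"
    by (rule mat_app_cong) (simp add: u_def)
  ultimately show ?thesis by simp
qed

lemma augmentation_surj:
  assumes "y \<in> I"
  shows "\<exists>v. mat_app (D 0) v 0 = y"
proof -
  have "vec 1 (\<lambda>_. y) \<in> {y \<in> carrier_vec 1. y $ 0 \<in> I}"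
    using assms by simp
  then obtain v where v: "v \<in> carrier_vec (dim_col (D 0))" "vec 1 (\<lambda>_. y) = D 0 *\<^sub>v v"
    unfolding augmentation_image[symmetric] by blast
  have "y = vec 1 (\<lambda>_. y) $ 0" by simp
  also have "\<dots> = mat_app (D 0) (\<lambda>l. v $ l) 0"
    unfolding v(2) using v(1) by (intro mult_mat_vec_mat_app) (simp_all add: dim_row_0)
  finally show ?thesis by metis
qed

text \<open>The complex is augmented: for \<open>i = 0\<close> the single row of \<open>D 0\<close>
  asks that \<open>v\<close> maps to zero in \<open>S\<close>.\<close>

lemma exact:
  assumes "\<And>k. k < dim_row (D i) \<Longrightarrow> mat_app (D i) v k = 0"
  shows "\<exists>w. \<forall>l<dim_col (D i). v l = mat_app (D (Suc i)) w l"
proof -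
  define u where "u = vec (dim_col (D i)) v"
  have u: "u \<in> carrier_vec (dim_col (D i))" by (simp add: u_def)
  have "(D i *\<^sub>v u) $ k = 0" if "k < dim_row (D i)" for k
  proof -
    have "(D i *\<^sub>v u) $ k = mat_app (D i) (\<lambda>l. u $ l) k"
      using that u by (rule mult_mat_vec_mat_app)
    also have "\<dots> = mat_app (D i) v k"
      by (rule mat_app_cong) (simp add: u_def)
    finally show ?thesis using assms[OF that] by simp
  qed
  then have "D i *\<^sub>v u = 0\<^sub>v (dim_row (D i))"
    by (intro eq_vecI) auto
  then have "u \<in> mat_kernel (D i)"
    using u by (simp add: mat_kernel_def)
  then obtain w where w: "w \<in> carrier_vec (dim_col (D (Suc i)))" "u = D (Suc i) *\<^sub>v w"
    unfolding image_eq_kernel[symmetric] by blast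
  have "v l = mat_app (D (Suc i)) (\<lambda>m. w $ m) l" if "l < dim_col (D i)" for l
  proof -
    have "v l = u $ l" using that by (simp add: u_def)
    also have "\<dots> = mat_app (D (Suc i)) (\<lambda>m. w $ m) l"
      unfolding w(2) using that w(1) by (intro mult_mat_vec_mat_app) (simp_all add: dim_row_Suc)
    finally show ?thesis .
  qed
  then show ?thesis by blast
qed

lemma complex_zero:
  assumes "k < dim_row (D i)"
  shows "mat_app (D i) (mat_app (D (Suc i)) w) k = 0"
proof -
  define u where "u = vec (dim_col (D (Suc i))) w"
  define y where "y = D (Suc i) *\<^sub>v u"
  have u: "u \<in> carrier_vec (dim_col (D (Suc i)))" by (simp add: u_def)
  have y: "y \<in> mat_kernel (D i)"
    unfolding y_def image_eq_kernel[symmetric] using u by blast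
  have "y $ l = mat_app (D (Suc i)) w l" if "l < dim_col (D i)" for l
  proof -
    have "y $ l = mat_app (D (Suc i)) (\<lambda>m. u $ m) l"
      unfolding y_def using that u by (intro mult_mat_vec_mat_app) (simp_all add: dim_row_Suc)
    also have "\<dots> = mat_app (D (Suc i)) w l"
      by (rule mat_app_cong) (simp add: u_def)
    finally show ?thesis .
  qed
  then have "mat_app (D i) (mat_app (D (Suc i)) w) k = mat_app (D i) (\<lambda>l. y $ l) k"
    by (intro mat_app_cong) simp
  also have "\<dots> = (D i *\<^sub>v y) $ k"
    using assms y by (intro mult_mat_vec_mat_app[symmetric]) (simp_all add: mat_kernel_def)
  also have "\<dots> = 0"
    using assms y by (simp add: mat_kernel_def)
  finally show ?thesis .
qed

lemma homogeneous_mat_app: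
  assumes "homogeneous_elem i j v" "k < dim_row (D i)"
  shows "homogeneous (j - row_deg i k) (mat_app (D i) v k)"
  unfolding mat_app_def
proof (rule homogeneous_sum)
  fix l assume "l \<in> {..<dim_col (D i)}"
  then have "homogeneous ((g i l - row_deg i k) + (j - g i l)) (D i $$ (k, l) * v l)"
    using assms by (intro homogeneous_mult homogeneous_entry) (auto simp: homogeneous_elem_def)
  then show "homogeneous (j - row_deg i k) (D i $$ (k, l) * v l)" by simp
qed

text \<open>The matrices are homogeneous and \<open>(X)\<close> contains the components of its
  elements, so the components of suitable degrees in a preimage \<open>w\<close> solve the same
  congruence.\<close>

lemma homogeneous_preimage:
  assumes "homogeneous_elem i j v" "\<And>l. l < dim_col (D i) \<Longrightarrow> v l - mat_app (D (Suc i)) w l \<in> var_ideal X"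
  shows "\<exists>w. homogeneous_elem (Suc i) j w \<and>
    (\<forall>l<dim_col (D i). v l - mat_app (D (Suc i)) w l \<in> var_ideal X)"
proof (intro exI conjI allI impI)
  define w' where "w' m = hcomp (j - g (Suc i) m) (w m)" for m
  show "homogeneous_elem (Suc i) j w'"
    by (simp add: homogeneous_elem_def w'_def homogeneous_hcomp)
  fix l assume l: "l < dim_col (D i)"
  have "hcomp (j - g i l) (mat_app (D (Suc i)) w l) = mat_app (D (Suc i)) w' l"
    unfolding mat_app_def hcomp_sum
  proof (rule sum.cong)
    fix m assume "m \<in> {..<dim_col (D (Suc i))}"
    then have "homogeneous (g (Suc i) m - g i l) (D (Suc i) $$ (l, m))"
      using homogeneous_entry[of l "Suc i" m] l by (simp add: row_deg_def dim_row_Suc)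
    from hcomp_mult[OF this, of "j - g (Suc i) m" "w m"]
    show "hcomp (j - g i l) (D (Suc i) $$ (l, m) * w m) = D (Suc i) $$ (l, m) * w' m"
      by (simp add: w'_def)
  qed simp
  moreover have "hcomp (j - g i l) (v l) = v l"
    using assms(1) l by (intro hcomp_homogeneous) (simp add: homogeneous_elem_def)
  ultimately show "v l - mat_app (D (Suc i)) w' l \<in> var_ideal X"
    using hcomp_var_ideal[OF assms(2)[OF l], of "j - g i l"] by (simp add: hcomp_diff)
qed

section \<open>Vanishing of homology modulo a final segment of variables\<close>

text \<open>In degrees above \<open>e\<close>, an element of \<open>I \<inter> (X)\<close> lies in \<open>(X) I\<close>.\<close>

lemma homology_mod_variables_vanishes_0:
  assumes mono: "monomial_ideal I"
    and divide: "\<And>u. u \<in> exponents I \<Longrightarrow> int (mdeg u) > e \<Longrightarrow> \<exists>k\<in>X. 0 < Poly_Mapping.lookup u k \<Longrightarrow>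
        \<exists>k\<in>X. \<exists>v\<in>exponents I. u = v + Poly_Mapping.single k 1"
    and "j > e" "homogeneous_elem 0 j v" "mat_app (D 0) v 0 \<in> var_ideal X"
  shows "\<exists>w. \<forall>l<dim_col (D 0). v l - mat_app (D (Suc 0)) w l \<in> var_ideal X"
proof -
  define p where "p = mat_app (D 0) v 0"
  have p: "Poly_Mapping.keys p \<subseteq> exponents I" "homogeneous j p" "p \<in> var_ideal X"
    using monomial_ideal_mem_iff[OF mono] augmentation_in_ideal[of v]
      homogeneous_mat_app[OF assms(4), of 0] assms(5)
    by (auto simp: p_def dim_row_0 row_deg_def)
  \<comment> \<open>Each term of \<open>p\<close> is a scalar times a variable of \<open>X\<close>
    times a monomial of \<open>I\<close>; a preimage of that monomial is multiplied by the scalar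
    and the variable.\<close>
  have "\<exists>z. (\<forall>l. z l \<in> var_ideal X) \<and> mat_app (D 0) z 0 = Poly_Mapping.single u (Poly_Mapping.lookup p u)"
    if u: "u \<in> Poly_Mapping.keys p" for u
  proof -
    have "int (mdeg u) > e" using p(2) u assms(3) by (simp add: homogeneous_def)
    then obtain k t where kt: "k \<in> X" "t \<in> exponents I" "u = t + Poly_Mapping.single k 1"
      using divide[of u] p(1,3) u unfolding var_ideal_def by blast
    obtain z where z: "mat_app (D 0) z 0 = monomial t"
      using augmentation_surj[of "monomial t"] kt(2) by (auto simp: exponents_def)
    define x where "x = Poly_Mapping.single (Poly_Mapping.single k (1::nat)) (Poly_Mapping.lookup p u)"
    have "z l * x \<in> var_ideal X" for l
      unfolding x_def using kt(1) by (intro var_ideal_mult single_mem_var_ideal)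
    then have "x * z l \<in> var_ideal X" for l
      by (simp add: mult.commute)
    moreover have "mat_app (D 0) (\<lambda>l. x * z l) 0 = Poly_Mapping.single u (Poly_Mapping.lookup p u)"
      unfolding mat_app_scale z by (simp add: x_def monomial_def mult_single kt(3) add.commute)
    ultimately show ?thesis by (intro exI[of _ "\<lambda>l. x * z l"]) simp
  qed
  then obtain z where z: "\<And>u l. u \<in> Poly_Mapping.keys p \<Longrightarrow> z u l \<in> var_ideal X"
    "\<And>u. u \<in> Poly_Mapping.keys p \<Longrightarrow> mat_app (D 0) (z u) 0 = Poly_Mapping.single u (Poly_Mapping.lookup p u)"
    by metis
  define s where "s l = (\<Sum>u\<in>Poly_Mapping.keys p. z u l)" for l
  \<comment> \<open>\<open>s\<close> has coordinates in \<open>(X)\<close> and the same image as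
    \<open>v\<close>, so exactness turns \<open>v - s\<close> into a boundary.\<close>
  have "mat_app (D 0) s 0 = p"
    unfolding s_def mat_app_sum using z(2) poly_mapping_sum_single[of p] by simp
  then have "mat_app (D 0) (\<lambda>l. v l - s l) k = 0" if "k < dim_row (D 0)" for k
    using that by (simp add: mat_app_diff p_def dim_row_0)
  from exact[OF this] obtain w where w: "\<forall>l<dim_col (D 0). v l - s l = mat_app (D (Suc 0)) w l"
    by blast
  have "v l - mat_app (D (Suc 0)) w l \<in> var_ideal X" if "l < dim_col (D 0)" for l
  proof -
    have "v l - mat_app (D (Suc 0)) w l = s l"
      using w[rule_format, OF that] by (simp add: algebra_simps)
    moreover have "s l \<in> var_ideal X"
      unfolding s_def using z(1) by (rule var_ideal_sum)
    ultimately show ?thesis by simp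
  qed
  then show ?thesis by blast
qed

text \<open>This is the long exact sequence for multiplication by the new variable, done on
  elements. The induction adds variables before those already present, so every stage is a final
  segment. For \<open>i > 0\<close> the induction hypothesis enters twice: at \<open>i - 1\<close>
  in degree \<open>j - 1\<close>, and at \<open>i\<close> in degree \<open>j\<close>.\<close>

lemma homology_mod_variables_vanishes:
  assumes mono: "monomial_ideal I"
    and divide: "\<And>X u. (\<And>k l. k \<in> X \<Longrightarrow> k \<le> l \<Longrightarrow> l \<in> X) \<Longrightarrow> u \<in> exponents I \<Longrightarrow>
        int (mdeg u) > e \<Longrightarrow> \<exists>k\<in>X. 0 < Poly_Mapping.lookup u k \<Longrightarrow>
        \<exists>k\<in>X. \<exists>v\<in>exponents I. u = v + Poly_Mapping.single k 1"
    and "\<And>k l. k \<in> X \<Longrightarrow> k \<le> l \<Longrightarrow> l \<in> X" "j > int i + e" "homogeneous_elem i j v"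
    and "\<And>k. k < dim_row (D i) \<Longrightarrow> mat_app (D i) v k \<in> var_ideal X"
  shows "\<exists>w. homogeneous_elem (Suc i) j w \<and>
    (\<forall>l<dim_col (D i). v l - mat_app (D (Suc i)) w l \<in> var_ideal X)"
  using finite[of X] assms(3-6)
proof (induction X arbitrary: i j v rule: finite_linorder_min_induct)
  case empty
  have "mat_app (D i) v k = 0" if "k < dim_row (D i)" for k
    using empty.prems(4)[OF that] by (simp add: var_ideal_empty)
  from exact[OF this] obtain w where "\<forall>l<dim_col (D i). v l = mat_app (D (Suc i)) w l" by blast
  then show ?case
    using empty.prems(3) by (intro homogeneous_preimage[of _ _ _ w]) auto
next
  case (insert b X)
  show ?case
  proof (cases i)
    case 0
    have "\<exists>w. \<forall>l<dim_col (D 0). v l - mat_app (D (Suc 0)) w l \<in> var_ideal (insert b X)"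
    proof (rule homology_mod_variables_vanishes_0[OF mono, of e _ j])
      fix u assume "u \<in> exponents I" "e < int (mdeg u)" "\<exists>k\<in>insert b X. 0 < Poly_Mapping.lookup u k"
      with insert.prems(1) show "\<exists>k\<in>insert b X. \<exists>v\<in>exponents I. u = v + Poly_Mapping.single k 1"
        by (rule divide)
    qed (use insert.prems 0 dim_row_0 in auto)
    then show ?thesis
      using insert.prems(3) homogeneous_preimage[of i j v] 0 by blast
  next
    case (Suc i')
    define x :: "('n, 'k) mpoly" where "x = monomial (Poly_Mapping.single b 1)"
    have up: "l \<in> X" if "k \<in> X" "k \<le> l" for k l
      using insert.prems(1)[of k l] insert.hyps(2) that by force
    have b: "b \<notin> X" using insert.hyps(2) by blast
    define q where "q = mat_app (D (Suc i')) v"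
    \<comment> \<open>The image \<open>q\<close> of \<open>v\<close> vanishes modulo
      \<open>x\<close> and \<open>(X)\<close>; \<open>c\<close> is its quotient by \<open>x\<close>
      modulo \<open>(X)\<close>, one degree lower.\<close>
    have "\<exists>c. homogeneous (j - 1 - g i' r) c \<and> q r - x * c \<in> var_ideal X" if "r < dim_col (D i')" for r
    proof -
      have "q r \<in> var_ideal (insert b X)"
        using insert.prems(4)[of r] that by (simp add: Suc q_def dim_row_Suc)
      moreover have "homogeneous (j - g i' r) (q r)"
        using homogeneous_mat_app[OF insert.prems(3), of r] that by (simp add: Suc q_def dim_row_Suc row_deg_def)
      ultimately show ?thesis
        using var_ideal_insert_split[of "q r" b X "j - g i' r"] by (simp add: x_def algebra_simps)
    qed
    then obtain c where c: "\<And>r. r < dim_col (D i') \<Longrightarrow> homogeneous (j - 1 - g i' r) (c r)"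
      "\<And>r. r < dim_col (D i') \<Longrightarrow> q r - x * c r \<in> var_ideal X" by metis
    \<comment> \<open>Modulo \<open>(X)\<close>, \<open>x\<close> times the image of
      \<open>c\<close> is the image of \<open>q\<close>, which is zero since successive maps compose
      to zero; then \<open>x\<close> is cancelled.\<close>
    have c_cycle: "mat_app (D i') c k \<in> var_ideal X" if "k < dim_row (D i')" for k
    proof -
      have "mat_app (D i') (\<lambda>r. q r - x * c r) k \<in> var_ideal X"
        using c(2) by (rule mat_app_var_ideal)
      moreover have "mat_app (D i') q k = 0"
        unfolding q_def using that by (rule complex_zero)
      ultimately have "- (x * mat_app (D i') c k) \<in> var_ideal X"
        by (simp add: mat_app_diff mat_app_scale)
      then have "x * mat_app (D i') c k \<in> var_ideal X"
        using var_ideal_uminus by fastforce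
      then show ?thesis unfolding x_def using b by (rule var_ideal_cancel)
    qed
    have c_hom: "homogeneous_elem i' (j - 1) c"
      using c(1) by (simp add: homogeneous_elem_def)
    have c_deg: "j - 1 > int i' + e" using insert.prems(2) Suc by simp
    have "\<exists>w. homogeneous_elem (Suc i') (j - 1) w \<and>
        (\<forall>r<dim_col (D i'). c r - mat_app (D (Suc i')) w r \<in> var_ideal X)"
      by (rule insert.IH[OF _ c_deg c_hom]) (fact up, fact c_cycle)
    then obtain w where w: "homogeneous_elem (Suc i') (j - 1) w"
      "\<And>r. r < dim_col (D i') \<Longrightarrow> c r - mat_app (D (Suc i')) w r \<in> var_ideal X"
      by blast
    \<comment> \<open>Subtracting \<open>x * w\<close> makes the image of \<open>v\<close> vanish
      modulo \<open>(X)\<close> alone, and changes nothing modulo \<open>x\<close>.\<close>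
    define v' where "v' l = v l - x * w l" for l
    have x_hom: "homogeneous 1 x" by (simp add: x_def homogeneous_def)
    have v_hom: "homogeneous_elem (Suc i') j v'"
      unfolding homogeneous_elem_def
    proof (intro allI impI)
      fix l assume l: "l < dim_col (D (Suc i'))"
      have "homogeneous (1 + (j - 1 - g (Suc i') l)) (x * w l)"
        using w(1) l by (intro homogeneous_mult x_hom) (simp add: homogeneous_elem_def)
      then show "homogeneous (j - g (Suc i') l) (v' l)"
        using insert.prems(3) l unfolding v'_def Suc homogeneous_elem_def by (intro homogeneous_diff) simp_all
    qed
    have v_cycle: "mat_app (D (Suc i')) v' r \<in> var_ideal X" if "r < dim_row (D (Suc i'))" for r
    proof -
      have "mat_app (D (Suc i')) v' r = (q r - x * c r) + x * (c r - mat_app (D (Suc i')) w r)"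
        by (simp add: v'_def[abs_def] mat_app_diff mat_app_scale q_def right_diff_distrib)
      then show ?thesis
        using that c(2) w(2) by (auto simp: dim_row_Suc intro!: var_ideal_add var_ideal_mult)
    qed
    have v_deg: "j > int (Suc i') + e" using insert.prems(2) Suc by simp
    have "\<exists>z. homogeneous_elem (Suc (Suc i')) j z \<and>
        (\<forall>l<dim_col (D (Suc i')). v' l - mat_app (D (Suc (Suc i'))) z l \<in> var_ideal X)"
      by (rule insert.IH[OF _ v_deg v_hom]) (fact up, fact v_cycle)
    then obtain z where z: "homogeneous_elem (Suc (Suc i')) j z"
      "\<And>l. l < dim_col (D (Suc i')) \<Longrightarrow> v' l - mat_app (D (Suc (Suc i'))) z l \<in> var_ideal X"
      by blast
    have "v l - mat_app (D (Suc (Suc i'))) z l \<in> var_ideal (insert b X)"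
      if "l < dim_col (D (Suc i'))" for l
    proof -
      have "v' l - mat_app (D (Suc (Suc i'))) z l \<in> var_ideal (insert b X)"
        using z(2)[OF that] by (rule var_ideal_mono) auto
      moreover have "w l * x \<in> var_ideal (insert b X)"
        unfolding x_def monomial_def by (intro var_ideal_mult single_mem_var_ideal) simp
      ultimately have "(v' l - mat_app (D (Suc (Suc i'))) z l) + w l * x \<in> var_ideal (insert b X)"
        by (rule var_ideal_add)
      then show ?thesis by (simp add: v'_def algebra_simps)
    qed
    then show ?thesis using z(1) Suc by blast
  qed
qed

section \<open>From homology modulo all variables to Tor\<close>

lemma tensor_diff_index:
  assumes "k < dim_row (D i)" "v \<in> carrier_vec (dim_col (D i))"
  shows "(tensor_diff D i *\<^sub>v v) $ k = (\<Sum>l<dim_col (D i). Poly_Mapping.lookup (D i $$ (k, l)) 0 * v $ l)"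
proof -
  have "(tensor_diff D i *\<^sub>v v) $ k = mat_app (tensor_diff D i) (\<lambda>l. v $ l) k"
    using assms by (intro mult_mat_vec_mat_app) (simp_all add: tensor_diff_def)
  then show ?thesis using assms(1) by (simp add: mat_app_def tensor_diff_def)
qed

text \<open>Here \<open>X\<close> consists of all variables: \<open>v\<close> is lifted to constant
  coordinates, and the constant terms of a homogeneous preimage exhibit it as a boundary. Since
  \<open>I\<close> is proper, the augmentation vanishes modulo all variables, so dropping it does
  not change the cycles for \<open>i = 0\<close>.\<close>

lemma tor_cycles_boundaries:
  assumes "monomial_ideal I" "I \<noteq> UNIV"
    and "\<And>X u. (\<And>k l. k \<in> X \<Longrightarrow> k \<le> l \<Longrightarrow> l \<in> X) \<Longrightarrow> u \<in> exponents I \<Longrightarrow>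
        int (mdeg u) > e \<Longrightarrow> \<exists>k\<in>X. 0 < Poly_Mapping.lookup u k \<Longrightarrow>
        \<exists>k\<in>X. \<exists>v\<in>exponents I. u = v + Poly_Mapping.single k 1"
    and "j > int i + e"
  shows "tor_cycles g D i j \<subseteq> tor_boundaries g D i j"
proof
  fix v assume v: "v \<in> tor_cycles g D i j"
  then have comp: "v \<in> tensor_component g D i j"
    by (auto simp: tor_cycles_def split: if_splits)
  then have vc: "v \<in> carrier_vec (dim_col (D i))" by (simp add: tensor_component_def)
  define V where "V l = Poly_Mapping.single (0 :: 'n \<Rightarrow>\<^sub>0 nat) (v $ l)" for l
  \<comment> \<open>\<open>v\<close> is supported on basis elements of degree \<open>j\<close>,
    where constants have the required degree 0.\<close>
  have hom: "homogeneous_elem i j V"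
    using comp by (fastforce simp: homogeneous_elem_def tensor_component_def homogeneous_def V_def mdeg_def
        split: if_splits)
  have "mat_app (D i) V k \<in> var_ideal UNIV" if k: "k < dim_row (D i)" for k
  proof (cases i)
    case 0
    have "0 \<notin> exponents I" using monomial_ideal_eq_UNIV(2)[OF assms(1)] assms(2) by blast
    moreover have "Poly_Mapping.keys (mat_app (D 0) V 0) \<subseteq> exponents I"
      using monomial_ideal_mem_iff[OF assms(1)] augmentation_in_ideal by blast
    ultimately show ?thesis
      using k by (auto simp: 0 dim_row_0 mem_var_ideal_UNIV_iff in_keys_iff)
  next
    case (Suc i')
    then have "tensor_diff D i *\<^sub>v v = 0\<^sub>v (dim_row (D i))"
      using v by (simp add: tor_cycles_def mat_kernel_def tensor_diff_def)
    then have "(\<Sum>l<dim_col (D i). Poly_Mapping.lookup (D i $$ (k, l)) 0 * v $ l) = 0"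
      using tensor_diff_index[OF k vc] k by simp
    then show ?thesis
      by (simp add: mem_var_ideal_UNIV_iff mat_app_def lookup_sum lookup_mult_0 V_def)
  qed
  then obtain w where w: "homogeneous_elem (Suc i) j w"
    "\<And>l. l < dim_col (D i) \<Longrightarrow> V l - mat_app (D (Suc i)) w l \<in> var_ideal UNIV"
    using homology_mod_variables_vanishes[OF assms(1,3), of e UNIV i j V] assms(4) hom by blast
  define u where "u = vec (dim_col (D (Suc i))) (\<lambda>m. Poly_Mapping.lookup (w m) 0)"
  have uc: "u \<in> carrier_vec (dim_col (D (Suc i)))" by (simp add: u_def)
  \<comment> \<open>A homogeneous coordinate has a nonzero constant term only if its degree is
    0.\<close>
  have "Poly_Mapping.lookup (w m) 0 = 0" if "m < dim_col (D (Suc i))" "g (Suc i) m \<noteq> j" for m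
  proof (rule ccontr)
    assume "Poly_Mapping.lookup (w m) 0 \<noteq> 0"
    then have "int (mdeg (0 :: 'n \<Rightarrow>\<^sub>0 nat)) = j - g (Suc i) m"
      using w(1) that(1) unfolding homogeneous_elem_def homogeneous_def by (simp add: in_keys_iff)
    then show False using that(2) by (simp add: mdeg_def)
  qed
  then have "u \<in> tensor_component g D (Suc i) j"
    by (auto simp: tensor_component_def u_def)
  moreover have "tensor_diff D (Suc i) *\<^sub>v u = v"
  proof (rule eq_vecI)
    show "dim_vec (tensor_diff D (Suc i) *\<^sub>v u) = dim_vec v"
      using vc by (simp add: tensor_diff_def dim_row_Suc)
    fix l assume "l < dim_vec v"
    then have l: "l < dim_col (D i)" using vc by simp
    have "(tensor_diff D (Suc i) *\<^sub>v u) $ l =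
        (\<Sum>m<dim_col (D (Suc i)). Poly_Mapping.lookup (D (Suc i) $$ (l, m)) 0 * u $ m)"
      using l uc by (intro tensor_diff_index) (simp_all add: dim_row_Suc)
    also have "\<dots> = Poly_Mapping.lookup (mat_app (D (Suc i)) w l) 0"
      by (simp add: mat_app_def lookup_sum lookup_mult_0 u_def)
    also have "\<dots> = v $ l"
      using w(2)[OF l] by (simp add: mem_var_ideal_UNIV_iff lookup_minus V_def)
    finally show "(tensor_diff D (Suc i) *\<^sub>v u) $ l = v $ l" .
  qed
  ultimately show "v \<in> tor_boundaries g D i j"
    unfolding tor_boundaries_def by blast
qed

end

section \<open>The regularity bound\<close>

lemma D_fixed_reg_le:
  fixes I :: "('n::{finite,linorder}, 'k::field) mpoly set"
  assumes "D_fixed I" "I \<noteq> UNIV"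
  shows "reg I \<le> ereal (of_int (int CARD('n) * (int (ideal_deg I) - 1) + 1))"
  unfolding reg_def
proof (rule Sup_least, clarify)
  define e where "e = int CARD('n) * (int (ideal_deg I) - 1) + 1"
  fix i j assume "Tor_nonzero I i j"
  then obtain g D where gD: "graded_free_resolution I g D" "\<not> tor_cycles g D i j \<subseteq> tor_boundaries g D i j"
    unfolding Tor_nonzero_def by blast
  interpret resolution I g D by unfold_locales (rule gD(1))
  have "\<not> j > int i + e"
  proof
    assume "j > int i + e"
    then have "tor_cycles g D i j \<subseteq> tor_boundaries g D i j"
      using D_fixed_divide_large[OF assms] D_fixed_monomial_ideal[OF assms(1)] assms(2)
      by (intro tor_cycles_boundaries[of e]) (auto simp: e_def)
    then show False using gD(2) by blast
  qed
  then have "j - int i \<le> e" by simp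
  then have "real_of_int (j - int i) \<le> real_of_int e" by (rule iffD2[OF of_int_le_iff])
  then show "ereal (of_int (j - int i)) \<le> ereal (of_int (int CARD('n) * (int (ideal_deg I) - 1) + 1))"
    by (simp only: e_def ereal_less_eq)
qed

text \<open>For the unit ideal \<open>ideal_deg I\<close> is 0 and the bound \<open>1 - n\<close> is
  negative, while its Tor in homological degree 0 is nonzero in degree 0. The regularity bound is
  therefore stated for proper ideals.\<close>

theorem corollary2p6:
  fixes I :: "('n::{finite,linorder}, 'k::field) mpoly set"
  assumes "infinite (UNIV :: 'k set)"
    and "CARD('n) \<ge> 2"
    and "D_fixed I"
  shows "(I \<noteq> UNIV \<longrightarrow>
            reg I \<le> ereal (of_int (int CARD('n) * (int (ideal_deg I) - 1) + 1))) \<and>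
         (\<forall>e. e \<ge> int CARD('n) * (int (ideal_deg I) - 1) + 1 \<longrightarrow> stable_ideal (truncation_ge e I))"
  using D_fixed_reg_le[OF assms(3)] D_fixed_truncation_stable[OF assms(3)] by blast

end
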